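(* Let $H \in \mathbb{R}^{d\times d}$ be symmetric positive semidefinite, $A \in \mathbb{R}^{m\times d}$ with $m \le d$, and let $\rho,\delta>0$. Let $\Theta$ and $\widehat{\Theta}$ be two $d\times d$ diagonal matrices with strictly positive diagonal entries, with $\Theta \neq \widehat{\Theta}$. Define $$D_A:=(\delta I + (\widehat{\Theta}^{-1}+\rho I )^{-1})^{-1} -(\delta I + (\Theta^{-1}+\rho I )^{-1})^{-1}, \qquad D_C:=\widehat{\Theta}^{-1} -\Theta^{-1}.$$ Then $$\|S(\widehat{\Theta})-S(\Theta)\|_2=\|D_A\|_2<\|D_C\|_2=\|\mathcal{N}_{C}(\widehat{\Theta})-\mathcal{N}_{C}(\Theta)\|_2,$$ where $S(\cdot)$ and $\mathcal{N}_C(\cdot)$ are the matrices defined in the context.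
   Context: For $H \in \mathbb{R}^{d\times d}$ symmetric positive semidefinite, $A \in \mathbb{R}^{m\times d}$ ($A$ is not required to have full rank), regularization parameters $\rho,\delta>0$, and a diagonal matrix $\Theta \in \mathbb{R}^{d \times d}$ with strictly positive diagonal entries (the interior point scaling matrix at some iteration), define the $(d+m)\times(d+m)$ matrices $$S(\Theta):= \begin{bmatrix} H+\rho I + (\delta I +(\Theta^{-1}+ \rho I)^{-1})^{-1} & A^T \\ A & -\delta I \end{bmatrix}, \qquad \mathcal{N}_{C}(\Theta):=\begin{bmatrix} H+\rho I +\Theta^{-1} & A^T \\ A & -\delta I \end{bmatrix}.$$ Here $I$ denotes the identity matrix of the appropriate size and $\|\cdot\|_2$ is the spectral norm. *)

theory Defs
  imports "HOL-Analysis.Analysis"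
begin

definition spectral_norm :: "real^'n^'m \<Rightarrow> real" where
  "spectral_norm M = onorm ((*v) M)"

definition psd_matrix :: "real^'n^'n \<Rightarrow> bool" where
  "psd_matrix H \<longleftrightarrow> transpose H = H \<and> (\<forall>x. 0 \<le> x \<bullet> (H *v x))"

definition pos_diagonal :: "real^'n^'n \<Rightarrow> bool" where
  "pos_diagonal T \<longleftrightarrow> (\<forall>i j. i \<noteq> j \<longrightarrow> T $ i $ j = 0) \<and> (\<forall>i. 0 < T $ i $ i)"

text \<open>In a block matrix the rows and columns are indexed by a sum type: \<^const>\<open>Inl\<close> selects
  the first (top or left) block and \<^const>\<open>Inr\<close> the second (bottom or right) block.\<close>

definition block_matrix ::
  "'a^'n^'m \<Rightarrow> 'a^'q^'m \<Rightarrow> 'a^'n^'p \<Rightarrow> 'a^'q^'p \<Rightarrow> 'a^('n + 'q)^('m + 'p)" where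
  "block_matrix P Q R U =
     (\<chi> i j. case i of
        Inl k \<Rightarrow> (case j of Inl l \<Rightarrow> P $ k $ l | Inr l \<Rightarrow> Q $ k $ l)
      | Inr k \<Rightarrow> (case j of Inl l \<Rightarrow> R $ k $ l | Inr l \<Rightarrow> U $ k $ l))"

definition S_matrix ::
  "real^'d^'d \<Rightarrow> real^'d^'m \<Rightarrow> real \<Rightarrow> real \<Rightarrow> real^'d^'d \<Rightarrow> real^('d + 'm)^('d + 'm)" where
  "S_matrix H A \<rho> \<delta> \<Theta> =
     block_matrix
       (H + \<rho> *\<^sub>R mat 1 + matrix_inv (\<delta> *\<^sub>R mat 1 + matrix_inv (matrix_inv \<Theta> + \<rho> *\<^sub>R mat 1)))
       (transpose A)
       A
       (- (\<delta> *\<^sub>R mat 1))"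

definition NC_matrix ::
  "real^'d^'d \<Rightarrow> real^'d^'m \<Rightarrow> real \<Rightarrow> real \<Rightarrow> real^'d^'d \<Rightarrow> real^('d + 'm)^('d + 'm)" where
  "NC_matrix H A \<rho> \<delta> \<Theta> =
     block_matrix
       (H + \<rho> *\<^sub>R mat 1 + matrix_inv \<Theta>)
       (transpose A)
       A
       (- (\<delta> *\<^sub>R mat 1))"

end

theory Submission
  imports Defs
begin

text \<open>All matrices involved are diagonal, and the two differences of block matrices have a single
  nonzero block.  The spectral norm of a diagonal matrix is the largest modulus of an entry.
  Entrywise \<open>D_A\<close> is \<open>f a - f b\<close> where \<open>D_C\<close> is \<open>a - b\<close>, with
  \<open>f t = 1 / (\<delta> + 1 / (t + \<rho>))\<close>, and \<open>f\<close> strictly contracts distances between positive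
  numbers, since \<open>f a - f b = (a - b) / ((\<delta> (a + \<rho>) + 1) (\<delta> (b + \<rho>) + 1))\<close>.\<close>

text \<open>Taking the diagonal as a function of the index lets sums, products and inverses of
  diagonal matrices be computed pointwise.\<close>

definition diag_mat :: "('n \<Rightarrow> real) \<Rightarrow> real^'n^'n" where
  "diag_mat v = (\<chi> i j. if i = j then v i else 0)"

lemma diag_mat_vector_mult: "(diag_mat v *v x) $ i = v i * x $ i"
  by (simp add: diag_mat_def matrix_vector_mult_def if_distrib[of "\<lambda>z. z * _"] cong: if_cong)

lemma diag_mat_mult: "diag_mat v ** diag_mat w = diag_mat (\<lambda>i. v i * w i)"
proof -
  have "(diag_mat v ** diag_mat w) *v x = diag_mat (\<lambda>i. v i * w i) *v x" for x
    by (simp add: vec_eq_iff diag_mat_vector_mult flip: matrix_vector_mul_assoc)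
  then show ?thesis
    by (simp add: matrix_eq)
qed

lemma mat_eq_diag_mat: "mat c = diag_mat (\<lambda>i. c)"
  by (simp add: mat_def diag_mat_def)

lemma diag_mat_add: "diag_mat v + diag_mat w = diag_mat (\<lambda>i. v i + w i)"
  by (simp add: diag_mat_def vec_eq_iff)

lemma diag_mat_diff: "diag_mat v - diag_mat w = diag_mat (\<lambda>i. v i - w i)"
  by (simp add: diag_mat_def vec_eq_iff)

lemma scaleR_diag_mat: "c *\<^sub>R diag_mat v = diag_mat (\<lambda>i. c * v i)"
  by (simp add: diag_mat_def vec_eq_iff)

lemma pos_diagonal_eq_diag_mat: "pos_diagonal T \<Longrightarrow> T = diag_mat (\<lambda>i. T $ i $ i)"
  by (simp add: pos_diagonal_def diag_mat_def vec_eq_iff)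

text \<open>The inverse is chosen among all two-sided inverses: \<open>Y\<close> shows that one
  exists, and bracketing the product of \<open>matrix_inv X\<close>, \<open>X\<close> and
  \<open>Y\<close> in two ways forces the choice to be \<open>Y\<close>.\<close>

lemma matrix_inv_eqI:
  fixes X :: "'a::semiring_1^'n^'m"
  assumes "X ** Y = mat 1" "Y ** X = mat 1"
  shows "matrix_inv X = Y"
proof -
  have inv: "X ** matrix_inv X = mat 1 \<and> matrix_inv X ** X = mat 1"
    unfolding matrix_inv_def by (rule someI[of _ Y]) (simp add: assms)
  have "matrix_inv X = matrix_inv X ** (X ** Y)"
    by (simp add: assms)
  also have "\<dots> = Y"
    using inv by (simp add: matrix_mul_assoc)
  finally show ?thesis .
qed

lemma matrix_inv_diag_mat:
  assumes "\<And>i. v i \<noteq> 0"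
  shows "matrix_inv (diag_mat v) = diag_mat (\<lambda>i. inverse (v i))"
proof -
  have "diag_mat v ** diag_mat (\<lambda>i. inverse (v i)) = mat 1"
    "diag_mat (\<lambda>i. inverse (v i)) ** diag_mat v = mat 1"
    using assms by (simp_all add: diag_mat_mult mat_eq_diag_mat)
  then show ?thesis
    by (rule matrix_inv_eqI)
qed

text \<open>Upper bound: each component of the image is at most the maximum times the same component
  of \<open>x\<close>. Lower bound: the unit vector \<open>axis i 1\<close> is scaled by
  \<open>v i\<close>.\<close>

lemma spectral_norm_diag_mat: "spectral_norm (diag_mat v) = Max (range (\<lambda>i. \<bar>v i\<bar>))" (is "_ = ?M")
proof (rule antisym)
  have le: "\<bar>v i\<bar> \<le> ?M" for i
    by (rule Max_ge) auto
  have M0: "0 \<le> ?M"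
    using order_trans[OF abs_ge_zero le] .
  show "spectral_norm (diag_mat v) \<le> ?M"
    unfolding spectral_norm_def
  proof (rule onorm_bound[OF M0])
    fix x :: "real^'a"
    have "norm (diag_mat v *v x) \<le> norm (?M *\<^sub>R x)"
    proof (rule norm_le_componentwise_cart)
      fix i
      have "\<bar>v i\<bar> * \<bar>x $ i\<bar> \<le> ?M * \<bar>x $ i\<bar>"
        by (rule mult_right_mono[OF le]) simp
      then show "norm ((diag_mat v *v x) $ i) \<le> norm ((?M *\<^sub>R x) $ i)"
        using M0 by (simp add: diag_mat_vector_mult abs_mult)
    qed
    then show "norm (diag_mat v *v x) \<le> ?M * norm x"
      using M0 by simp
  qed
  have "\<bar>v i\<bar> \<le> spectral_norm (diag_mat v)" for i
  proof -
    have "\<bar>v i\<bar> = \<bar>(diag_mat v *v axis i 1) $ i\<bar>"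
      by (simp add: diag_mat_vector_mult)
    also have "\<dots> \<le> norm (diag_mat v *v axis i 1)"
      by (rule component_le_norm_cart)
    also have "\<dots> \<le> onorm ((*v) (diag_mat v)) * norm (axis i 1 :: real^'a)"
      by (rule onorm) simp
    finally show ?thesis
      by (simp add: spectral_norm_def)
  qed
  then show "?M \<le> spectral_norm (diag_mat v)"
    by auto
qed

text \<open>Entrywise strictness survives because the maximum over finitely many entries is
  attained. Where \<open>w i\<close> vanishes no strict bound is possible; there
  \<open>v i = 0\<close> lies below the maximum since \<open>w k\<close> makes that
  positive.\<close>

lemma spectral_norm_diag_mat_less:
  assumes less: "\<And>i. w i \<noteq> 0 \<Longrightarrow> \<bar>v i\<bar> < \<bar>w i\<bar>"
    and zero: "\<And>i. w i = 0 \<Longrightarrow> v i = 0" and nz: "w k \<noteq> 0"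
  shows "spectral_norm (diag_mat v) < spectral_norm (diag_mat w)"
proof -
  have le: "\<bar>w i\<bar> \<le> Max (range (\<lambda>i. \<bar>w i\<bar>))" for i
    by (rule Max_ge) auto
  have "\<bar>v i\<bar> < Max (range (\<lambda>i. \<bar>w i\<bar>))" for i
  proof (cases "w i = 0")
    case True
    then show ?thesis
      using zero[OF True] nz less_le_trans[OF _ le[of k], of 0] by simp
  next
    case False
    show ?thesis
      using less[OF False] le[of i] by (rule less_le_trans)
  qed
  then show ?thesis
    by (auto simp: spectral_norm_diag_mat)
qed

lemma block_matrix_diff:
  "block_matrix P Q R U - block_matrix P' Q' R' U'
    = block_matrix (P - P') (Q - Q') (R - R') (U - U')"
  by (auto simp: block_matrix_def vec_eq_iff split: sum.split)

lemma sum_UNIV_Plus: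
  "sum f (UNIV :: ('n::finite + 'm::finite) set) = (\<Sum>i\<in>UNIV. f (Inl i)) + (\<Sum>i\<in>UNIV. f (Inr i))"
  unfolding UNIV_Plus_UNIV[symmetric] by (subst sum.Plus) (simp_all add: o_def)

text \<open>Pythagoras: the two blocks lie in orthogonal coordinate subspaces.\<close>

lemma norm_sum_vec:
  "(norm (x :: real^('n::finite + 'm::finite)))\<^sup>2 = (norm (\<chi> i. x $ Inl i))\<^sup>2 + (norm (\<chi> i. x $ Inr i))\<^sup>2"
  by (simp add: power2_norm_eq_inner inner_vec_def sum_UNIV_Plus)

text \<open>The block matrix applies \<open>P\<close> to the first block of a vector and discards
  the second. Dropping a block never increases the norm, which gives one inequality.\<close>

lemma spectral_norm_block_matrix_zero:
  fixes P :: "real^'n^'m"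
  shows "spectral_norm (block_matrix P (0 :: real^'q^'m) (0 :: real^'n^'p) 0) = spectral_norm P"
    (is "spectral_norm ?B = _")
proof (rule antisym)
  have norm_B: "norm (?B *v x) = norm (P *v (\<chi> i. x $ Inl i))" for x
  proof (rule power2_eq_imp_eq)
    have "(\<chi> i. (?B *v x) $ Inl i) = P *v (\<chi> i. x $ Inl i)" "(\<chi> i. (?B *v x) $ Inr i) = 0"
      by (simp_all add: vec_eq_iff matrix_vector_mult_def block_matrix_def sum_UNIV_Plus)
    then show "(norm (?B *v x))\<^sup>2 = (norm (P *v (\<chi> i. x $ Inl i)))\<^sup>2"
      by (simp add: norm_sum_vec)
  qed auto
  show "spectral_norm ?B \<le> spectral_norm P"
    unfolding spectral_norm_def
  proof (rule onorm_bound)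
    fix x :: "real^('n + 'q)"
    have "norm (\<chi> i. x $ Inl i) \<le> norm x"
      by (rule power2_le_imp_le) (simp_all add: norm_sum_vec[of x])
    moreover have "norm (?B *v x) \<le> onorm ((*v) P) * norm (\<chi> i. x $ Inl i)"
      unfolding norm_B by (rule onorm) simp
    ultimately show "norm (?B *v x) \<le> onorm ((*v) P) * norm x"
      by (meson order_trans mult_left_mono onorm_pos_le matrix_vector_mul_bounded_linear)
  qed (simp add: onorm_pos_le)
  show "spectral_norm P \<le> spectral_norm ?B"
    unfolding spectral_norm_def
  proof (rule onorm_bound)
    fix y :: "real^'n"
    \<comment> \<open>Padding \<open>y\<close> with zeros is isometric, so every value of
      \<open>P\<close> is realised by the block matrix on a vector of equal norm.\<close>
    define x :: "real^('n + 'q)" where "x = (\<chi> i. case i of Inl k \<Rightarrow> y $ k | Inr k \<Rightarrow> 0)"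
    have y: "(\<chi> i. x $ Inl i) = y" and "(\<chi> i. x $ Inr i) = 0"
      by (simp_all add: x_def vec_eq_iff)
    then have "(norm x)\<^sup>2 = (norm y)\<^sup>2"
      by (simp add: norm_sum_vec)
    then have "norm x = norm y"
      by simp
    moreover have "norm (?B *v x) \<le> onorm ((*v) ?B) * norm x"
      by (rule onorm) simp
    ultimately show "norm (P *v y) \<le> onorm ((*v) ?B) * norm y"
      by (simp add: norm_B y)
  qed (simp add: onorm_pos_le)
qed

lemma inverse_add_inverse_contracts:
  fixes a b \<rho> \<delta> :: real
  assumes "a > 0" "b > 0" "\<rho> > 0" "\<delta> > 0" "a \<noteq> b"
  shows "\<bar>inverse (\<delta> + inverse (a + \<rho>)) - inverse (\<delta> + inverse (b + \<rho>))\<bar> < \<bar>a - b\<bar>"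
proof -
  \<comment> \<open>The denominators left after clearing the inner inverses; both exceed 1.\<close>
  define p q where "p = \<delta> * (a + \<rho>) + 1" and "q = \<delta> * (b + \<rho>) + 1"
  have pq: "p > 1" "q > 1"
    using assms by (simp_all add: p_def q_def)
  have f: "inverse (\<delta> + inverse (t + \<rho>)) = (t + \<rho>) / (\<delta> * (t + \<rho>) + 1)" if "t > 0" for t
    using that assms by (simp add: field_simps)
  have "inverse (\<delta> + inverse (a + \<rho>)) - inverse (\<delta> + inverse (b + \<rho>))
      = (a + \<rho>) / p - (b + \<rho>) / q"
    using assms by (simp add: f p_def q_def)
  also have "\<dots> = (a - b) / (p * q)"
  proof -
    \<comment> \<open>The products \<open>\<delta> * (a + \<rho>) * (b + \<rho>)\<close> and the two
      copies of \<open>\<rho>\<close> cancel.\<close>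
    have "(a + \<rho>) * q - (b + \<rho>) * p = a - b"
      by (simp add: p_def q_def algebra_simps)
    then show ?thesis
      using pq by (simp add: diff_frac_eq)
  qed
  finally have "\<bar>inverse (\<delta> + inverse (a + \<rho>)) - inverse (\<delta> + inverse (b + \<rho>))\<bar>
      = \<bar>a - b\<bar> / (p * q)"
    using pq by (simp add: abs_mult)
  moreover have "1 < p * q"
    using pq by (rule less_1_mult)
  ultimately show ?thesis
    using assms by (simp add: divide_less_eq)
qed

theorem lemma3:
  fixes H :: "real^'d^'d" and A :: "real^'d^'m" and \<rho> \<delta> :: real
    and \<Theta> \<Theta>' :: "real^'d^'d" and D_A D_C :: "real^'d^'d"
  assumes "psd_matrix H"
    and "CARD('m) \<le> CARD('d)"
    and "\<rho> > 0" and "\<delta> > 0"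
    and "pos_diagonal \<Theta>" and "pos_diagonal \<Theta>'" and "\<Theta> \<noteq> \<Theta>'"
  defines "D_A \<equiv> matrix_inv (\<delta> *\<^sub>R mat 1 + matrix_inv (matrix_inv \<Theta>' + \<rho> *\<^sub>R mat 1))
                - matrix_inv (\<delta> *\<^sub>R mat 1 + matrix_inv (matrix_inv \<Theta> + \<rho> *\<^sub>R mat 1))"
    and "D_C \<equiv> matrix_inv \<Theta>' - matrix_inv \<Theta>"
  shows "spectral_norm (S_matrix H A \<rho> \<delta> \<Theta>' - S_matrix H A \<rho> \<delta> \<Theta>) = spectral_norm D_A
    \<and> spectral_norm D_A < spectral_norm D_C
    \<and> spectral_norm D_C = spectral_norm (NC_matrix H A \<rho> \<delta> \<Theta>' - NC_matrix H A \<rho> \<delta> \<Theta>)"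
proof (intro conjI)
  \<comment> \<open>The diagonals of the inverses, with \<open>a\<close> from the primed matrix so
    that signs match \<open>D_A\<close> and \<open>D_C\<close>.\<close>
  define a b where "a = (\<lambda>i. inverse (\<Theta>' $ i $ i))" and "b = (\<lambda>i. inverse (\<Theta> $ i $ i))"
  define f where "f = (\<lambda>t. inverse (\<delta> + inverse (t + \<rho>)))"
  have pos: "a i > 0" "b i > 0" for i
    using assms(5,6) by (simp_all add: a_def b_def pos_diagonal_def)
  have inv: "matrix_inv T = diag_mat (\<lambda>i. inverse (T $ i $ i))"
    if "pos_diagonal T" for T :: "real^'d^'d"
  proof -
    have "T $ i $ i \<noteq> 0" for i
      using that by (auto simp: pos_diagonal_def dest: spec[of _ i])
    then show ?thesis
      by (subst pos_diagonal_eq_diag_mat[OF that]) (rule matrix_inv_diag_mat)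
  qed
  have C: "D_C = diag_mat (\<lambda>i. a i - b i)"
    by (simp add: D_C_def inv assms(5,6) diag_mat_diff a_def b_def)
  \<comment> \<open>Positivity of \<open>c\<close> keeps the diagonal entries nonzero at both nested
    inversions.\<close>
  have F: "matrix_inv (\<delta> *\<^sub>R mat 1 + matrix_inv (diag_mat c + \<rho> *\<^sub>R mat 1)) = diag_mat (\<lambda>i. f (c i))"
    if "\<And>i. c i > 0" for c :: "'d \<Rightarrow> real"
  proof -
    have *: "c i + \<rho> > 0" for i
      using that[of i] assms(3) by simp
    then have "\<delta> + inverse (c i + \<rho>) > 0" for i
      using assms(4) by (simp add: add_pos_pos)
    with * show ?thesis
      by (simp add: f_def mat_eq_diag_mat scaleR_diag_mat diag_mat_add matrix_inv_diag_mat less_imp_neq[THEN not_sym])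
  qed
  have "D_A = diag_mat (\<lambda>i. f (a i)) - diag_mat (\<lambda>i. f (b i))"
    using F[of a] F[of b] pos by (simp add: D_A_def inv assms(5,6) a_def b_def)
  then have A: "D_A = diag_mat (\<lambda>i. f (a i) - f (b i))"
    by (simp add: diag_mat_diff)
  \<comment> \<open>Distinct diagonal matrices differ at some diagonal entry, and inversion is
    injective; this \<open>k\<close> is the nonzero entry of \<open>D_C\<close> behind the strict
    inequality.\<close>
  obtain k where "a k \<noteq> b k"
  proof -
    have "(\<lambda>k. \<Theta> $ k $ k) \<noteq> (\<lambda>k. \<Theta>' $ k $ k)"
      using assms(7) pos_diagonal_eq_diag_mat[OF assms(5)] pos_diagonal_eq_diag_mat[OF assms(6)] by auto
    then show ?thesis
      using that by (auto simp: a_def b_def fun_eq_iff dest: not_sym)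
  qed
  then show "spectral_norm D_A < spectral_norm D_C"
    unfolding A C
    by (intro spectral_norm_diag_mat_less[where k = k])
      (simp_all add: f_def inverse_add_inverse_contracts pos assms(3,4))
  \<comment> \<open>The blocks \<open>A\<close>, its transpose and the lower right one are
    independent of the scaling matrix and cancel, as do \<open>H\<close> and the
    \<open>\<rho>\<close> term in the upper left.\<close>
  have "S_matrix H A \<rho> \<delta> \<Theta>' - S_matrix H A \<rho> \<delta> \<Theta> = block_matrix D_A 0 0 0"
    by (simp add: S_matrix_def block_matrix_diff D_A_def)
  then show "spectral_norm (S_matrix H A \<rho> \<delta> \<Theta>' - S_matrix H A \<rho> \<delta> \<Theta>) = spectral_norm D_A"
    by (simp add: spectral_norm_block_matrix_zero)
  have "NC_matrix H A \<rho> \<delta> \<Theta>' - NC_matrix H A \<rho> \<delta> \<Theta> = block_matrix D_C 0 0 0"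
    by (simp add: NC_matrix_def block_matrix_diff D_C_def)
  then show "spectral_norm D_C = spectral_norm (NC_matrix H A \<rho> \<delta> \<Theta>' - NC_matrix H A \<rho> \<delta> \<Theta>)"
    by (simp add: spectral_norm_block_matrix_zero)
qed

end
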